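(* For every $\ell\ge 1$ for which $P(\bm{D}\in\mathcal{D}^\ell)>0$ (notation in the context), $$\mathrm{AVSQ}^n_\ell=E\left[\sum_{k=0}^{\ell-1}\omega^\ell_k\,\mathrm{SL}^\ell_k\,\middle|\,\bm{D}\in\mathcal{D}^\ell\right].$$ Moreover, $E\left[\sum_{k=0}^{\ell-1}\omega^\ell_k\,\middle|\,\bm{D}\in\mathcal{D}^\ell\right]=1$, and, on the event $\{\bm{D}\in\mathcal{D}^\ell\}$, $\omega^\ell_k\ge 0$ for all $k\in\{0,\dots,\ell-1\}$.
   Context: Setting. A panel of i.i.d. groups is observed at periods $t=1,\dots,T$; the group index is omitted. $D_t$ is the (real-valued) treatment at period $t$, with support $\mathcal{D}_t$; $\bm{D}=(D_1,\dots,D_T)$ is the treatment path, with support $\mathcal{D}$. $Y_t(d_1,\dots,d_t)$ is the potential outcome at period $t$ under treatments $(d_1,\dots,d_t)$ up to $t$ (no anticipation: period-$t$ potential outcomes do not depend on treatments after $t$). The observed outcome is $Y_t=Y_t(D_1,\dots,D_t)$. Potential outcomes are understood to be defined for every treatment sequence appearing below, and all expectations written are understood to be well defined and finite. $F=\min\{t\ge2:D_t\neq D_1\}$, with $F=T+1$ if the treatment never changes. $S=\mathrm{sgn}(D_F-D_1)$ if $F\le T$, $S=0$ otherwise. $\mathcal{D}^{\mathrm{r}}_1:=\{d\in\mathcal{D}_1:V(F\mid D_1=d)>0\}$. $\overline{T}_d:=\max\mathrm{Supp}(F-1\mid D_1=d)$. No-crossing paths until $t$: $$\mathcal{D}^{\mathrm{nc}}_t:=\Big\{(d_1,\dots,d_T)\in\mathcal{D}:\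 \text{either } \min_{1<s\le t}d_s\ge d_1\ \text{ or }\ \max_{1<s\le t}d_s\le d_1\Big\}.$$ For $\ell\ge1$, $$\mathcal{D}^\ell:=\Big\{(d_1,\dots,d_T)\in\mathcal{D}:\ d_1\in\mathcal{D}^{\mathrm{r}}_1,\ f-1+\ell\le\overline{T}_{d_1},\ (d_1,\dots,d_T)\in\mathcal{D}^{\mathrm{nc}}_{f-1+\ell}\Big\},\quad f:=\min\{t>1:d_t\neq d_1\}$$ (with $f=T+1$ if no such $t$ exists, in which case the path is not in $\mathcal{D}^\ell$ because $\overline{T}_{d_1}\le T$). Event-study effects: $$\mathrm{AVSQ}_\ell:=E\left[S\times\big(Y_{F-1+\ell}-Y_{F-1+\ell}(D_1,\dots,D_1)\big)\,\middle|\,\bm{D}\in\mathcal{D}^\ell\right],$$ $$\mathrm{AVSQ}^D_\ell:=E\left[S\sum_{k=0}^{\ell-1}(D_{F+k}-D_1)\,\middle|\,\bm{D}\in\mathcal{D}^\ell\right],\qquad \mathrm{AVSQ}^n_\ell:=\frac{\mathrm{AVSQ}_\ell}{\mathrm{AVSQ}^D_\ell},$$ where $Y_{t}(D_1,\dots,D_1)$ is the potential outcome at $t$ when the treatment is kept at $D_1$ from period 1 to $t$. For $k\in\{0,\dots,\ell-1\}$, on the event $\{\bm{D}\in\mathcal{D}^\ell\}$, $$\mathrm{SL}^\ell_k:=\frac{Y_{F-1+\ell}(D_1,\dots,D_{F-1+\ell-k-1},D_{F-1+\ell-k},D_1,\dots,D_1)-Y_{F-1+\ell}(D_1,\dots,D_{F-1+\ell-k-1},D_1,D_1,\dots,D_1)}{D_{F-1+\ell-k}-D_1},$$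 where in both terms the treatments at periods $1,\dots,F-1+\ell-k-1$ are at their actual values, the treatment at period $F-1+\ell-k$ is at its actual value in the first term and at $D_1$ in the second, and the treatments at the last $k$ periods $F-1+\ell-k+1,\dots,F-1+\ell$ equal $D_1$ (so there are none of these when $k=0$); the convention $0/0=0$ is used. Also, $$\omega^\ell_k:=\frac{S\times(D_{F-1+\ell-k}-D_1)}{\mathrm{AVSQ}^D_\ell}.$$ *)

theory Defs
  imports "HOL-Probability.Probability"
begin

text \<open>
  Throughout, \<open>T\<close> is the number of periods and periods are the naturals \<open>1, \<dots>, T\<close>.
  A treatment path is a function \<open>nat \<Rightarrow> real\<close> read on \<open>{1..T}\<close>;
  \<open>D t\<close> is the random treatment at period \<open>t\<close>.
  \<open>Y t ds\<close> is the random potential outcome at period \<open>t\<close> under the treatment history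
  \<open>ds = [d\<^sub>1, \<dots>, d\<^sub>t]\<close>; no anticipation is built in because the history stops at \<open>t\<close>.
\<close>

subsection \<open>Supports and conditioning\<close>

definition rv_support :: "'a measure \<Rightarrow> ('a \<Rightarrow> 'b::topological_space) \<Rightarrow> 'b set" where
  "rv_support M X =
     {x. \<forall>U. open U \<longrightarrow> x \<in> U \<longrightarrow> measure M {\<omega> \<in> space M. X \<omega> \<in> U} > 0}"

definition event_expectation :: "'a measure \<Rightarrow> 'a set \<Rightarrow> ('a \<Rightarrow> real) \<Rightarrow> real" where
  "event_expectation M A X = (LINT \<omega>:A|M. X \<omega>) / measure M A"

text \<open>
  \<open>K\<close> is a version of the conditional law of the discrete variable \<open>N\<close>, with values in \<open>R\<close>,
  given the real variable \<open>X\<close>: \<open>pmf (K x) n\<close> plays the role of \<open>P(N = n | X = x)\<close>.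
  No discreteness of \<open>X\<close> is needed; at atoms of \<open>X\<close> this is the elementary conditional law.
\<close>

definition conditional_law ::
  "'a measure \<Rightarrow> ('a \<Rightarrow> real) \<Rightarrow> ('a \<Rightarrow> nat) \<Rightarrow> nat set \<Rightarrow> (real \<Rightarrow> nat pmf) \<Rightarrow> bool" where
  "conditional_law M X N R K \<longleftrightarrow>
     (\<forall>x. set_pmf (K x) \<subseteq> R) \<and>
     (\<forall>n. (\<lambda>x. pmf (K x) n) \<in> borel_measurable borel) \<and>
     (\<forall>A \<in> sets borel. \<forall>n.
        measure M {\<omega> \<in> space M. X \<omega> \<in> A \<and> N \<omega> = n}
          = (LINT x:A|distr M borel X. pmf (K x) n))"

subsection \<open>Treatment paths\<close>

definition first_change :: "nat \<Rightarrow> (nat \<Rightarrow> real) \<Rightarrow> nat" where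
  "first_change T d =
     (if \<exists>t\<in>{2..T}. d t \<noteq> d 1 then Min {t \<in> {2..T}. d t \<noteq> d 1} else T + 1)"

text \<open>
  Paths are set to \<open>undefined\<close> outside \<open>{1..T}\<close>, so that the support of \<open>trt_path T D\<close> in the
  product topology on \<open>nat \<Rightarrow> real\<close> is the support of \<open>(D\<^sub>1, \<dots>, D\<^sub>T)\<close> in the \<open>T\<close>-dimensional space.
\<close>

definition trt_path :: "nat \<Rightarrow> (nat \<Rightarrow> 'a \<Rightarrow> real) \<Rightarrow> 'a \<Rightarrow> nat \<Rightarrow> real" where
  "trt_path T D \<omega> = (\<lambda>t\<in>{1..T}. D t \<omega>)"

definition F_of :: "nat \<Rightarrow> (nat \<Rightarrow> 'a \<Rightarrow> real) \<Rightarrow> 'a \<Rightarrow> nat" where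
  "F_of T D \<omega> = first_change T (\<lambda>t. D t \<omega>)"

definition S_of :: "nat \<Rightarrow> (nat \<Rightarrow> 'a \<Rightarrow> real) \<Rightarrow> 'a \<Rightarrow> real" where
  "S_of T D \<omega> =
     (if F_of T D \<omega> \<le> T then sgn (D (F_of T D \<omega>) \<omega> - D 1 \<omega>) else 0)"

text \<open>
  In the next two definitions \<open>K\<close> stands for the conditional law of \<open>F\<close> given \<open>D\<^sub>1\<close>.
\<close>

definition D1r ::
  "'a measure \<Rightarrow> (real \<Rightarrow> nat pmf) \<Rightarrow> (nat \<Rightarrow> 'a \<Rightarrow> real) \<Rightarrow> real set" where
  "D1r M K D = {d \<in> rv_support M (D 1). measure_pmf.variance (K d) real > 0}"

definition Tbar :: "(real \<Rightarrow> nat pmf) \<Rightarrow> real \<Rightarrow> nat" where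
  "Tbar K d = Max ((\<lambda>n. n - 1) ` set_pmf (K d))"

definition Dnc :: "'a measure \<Rightarrow> nat \<Rightarrow> (nat \<Rightarrow> 'a \<Rightarrow> real) \<Rightarrow> nat \<Rightarrow> (nat \<Rightarrow> real) set" where
  "Dnc M T D t =
     {d \<in> rv_support M (trt_path T D). Min (d ` {1<..t}) \<ge> d 1 \<or> Max (d ` {1<..t}) \<le> d 1}"

definition Dl ::
  "'a measure \<Rightarrow> nat \<Rightarrow> (real \<Rightarrow> nat pmf) \<Rightarrow> (nat \<Rightarrow> 'a \<Rightarrow> real) \<Rightarrow> nat \<Rightarrow> (nat \<Rightarrow> real) set" where
  "Dl M T K D l =
     {d \<in> rv_support M (trt_path T D).
        d 1 \<in> D1r M K D \<and>
        first_change T d - 1 + l \<le> Tbar K (d 1) \<and>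
        d \<in> Dnc M T D (first_change T d - 1 + l)}"

definition Dl_event ::
  "'a measure \<Rightarrow> nat \<Rightarrow> (real \<Rightarrow> nat pmf) \<Rightarrow> (nat \<Rightarrow> 'a \<Rightarrow> real) \<Rightarrow> nat \<Rightarrow> 'a set" where
  "Dl_event M T K D l = {\<omega> \<in> space M. trt_path T D \<omega> \<in> Dl M T K D l}"

subsection \<open>Outcomes and event-study effects\<close>

definition history :: "nat \<Rightarrow> (nat \<Rightarrow> real) \<Rightarrow> real list" where
  "history t d = map d [1..<Suc t]"

definition Yobs ::
  "(nat \<Rightarrow> 'a \<Rightarrow> real) \<Rightarrow> (nat \<Rightarrow> real list \<Rightarrow> 'a \<Rightarrow> real) \<Rightarrow> nat \<Rightarrow> 'a \<Rightarrow> real" where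
  "Yobs D Y t \<omega> = Y t (history t (\<lambda>s. D s \<omega>)) \<omega>"

text \<open>Potential outcome at \<open>t\<close> with actual treatments up to period \<open>m\<close> and \<open>D\<^sub>1\<close> afterwards.\<close>

definition Y_reset ::
  "(nat \<Rightarrow> 'a \<Rightarrow> real) \<Rightarrow> (nat \<Rightarrow> real list \<Rightarrow> 'a \<Rightarrow> real) \<Rightarrow> nat \<Rightarrow> nat \<Rightarrow> 'a \<Rightarrow> real" where
  "Y_reset D Y m t \<omega> = Y t (history t (\<lambda>s. if s \<le> m then D s \<omega> else D 1 \<omega>)) \<omega>"

definition effect_l ::
  "nat \<Rightarrow> (nat \<Rightarrow> 'a \<Rightarrow> real) \<Rightarrow> (nat \<Rightarrow> real list \<Rightarrow> 'a \<Rightarrow> real) \<Rightarrow> nat \<Rightarrow> 'a \<Rightarrow> real" where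
  "effect_l T D Y l \<omega> =
     (let t = F_of T D \<omega> - 1 + l
      in S_of T D \<omega> * (Yobs D Y t \<omega> - Y t (history t (\<lambda>s. D 1 \<omega>)) \<omega>))"

definition dose_l :: "nat \<Rightarrow> (nat \<Rightarrow> 'a \<Rightarrow> real) \<Rightarrow> nat \<Rightarrow> 'a \<Rightarrow> real" where
  "dose_l T D l \<omega> = S_of T D \<omega> * (\<Sum>k<l. (D (F_of T D \<omega> + k) \<omega> - D 1 \<omega>))"

definition AVSQ ::
  "'a measure \<Rightarrow> nat \<Rightarrow> (real \<Rightarrow> nat pmf) \<Rightarrow> (nat \<Rightarrow> 'a \<Rightarrow> real) \<Rightarrow>
   (nat \<Rightarrow> real list \<Rightarrow> 'a \<Rightarrow> real) \<Rightarrow> nat \<Rightarrow> real" where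
  "AVSQ M T K D Y l = event_expectation M (Dl_event M T K D l) (effect_l T D Y l)"

definition AVSQD ::
  "'a measure \<Rightarrow> nat \<Rightarrow> (real \<Rightarrow> nat pmf) \<Rightarrow> (nat \<Rightarrow> 'a \<Rightarrow> real) \<Rightarrow> nat \<Rightarrow> real" where
  "AVSQD M T K D l = event_expectation M (Dl_event M T K D l) (dose_l T D l)"

definition AVSQn ::
  "'a measure \<Rightarrow> nat \<Rightarrow> (real \<Rightarrow> nat pmf) \<Rightarrow> (nat \<Rightarrow> 'a \<Rightarrow> real) \<Rightarrow>
   (nat \<Rightarrow> real list \<Rightarrow> 'a \<Rightarrow> real) \<Rightarrow> nat \<Rightarrow> real" where
  "AVSQn M T K D Y l = AVSQ M T K D Y l / AVSQD M T K D l"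

text \<open>The convention \<open>0/0 = 0\<close> is that of HOL division.\<close>

definition SL ::
  "nat \<Rightarrow> (nat \<Rightarrow> 'a \<Rightarrow> real) \<Rightarrow> (nat \<Rightarrow> real list \<Rightarrow> 'a \<Rightarrow> real) \<Rightarrow> nat \<Rightarrow> nat \<Rightarrow> 'a \<Rightarrow> real" where
  "SL T D Y l k \<omega> =
     (let t = F_of T D \<omega> - 1 + l
      in (Y_reset D Y (t - k) t \<omega> - Y_reset D Y (t - k - 1) t \<omega>) / (D (t - k) \<omega> - D 1 \<omega>))"

definition weight ::
  "'a measure \<Rightarrow> nat \<Rightarrow> (real \<Rightarrow> nat pmf) \<Rightarrow> (nat \<Rightarrow> 'a \<Rightarrow> real) \<Rightarrow> nat \<Rightarrow> nat \<Rightarrow> 'a \<Rightarrow> real" where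
  "weight M T K D l k \<omega> =
     S_of T D \<omega> * (D (F_of T D \<omega> - 1 + l - k) \<omega> - D 1 \<omega>) / AVSQD M T K D l"

end

theory Submission
  imports Defs
begin

text \<open>
  On the conditioning event the path changes for the first time at some \<open>F \<le> T\<close> and then stays
  weakly on one side of \<open>D\<^sub>1\<close> up to period \<open>F - 1 + \<ell>\<close>. Hence all dose increments
  \<open>S (D\<^sub>s - D\<^sub>1)\<close> in that window are nonnegative, and the one at \<open>F\<close> is positive, which
  makes \<open>AVSQ\<^sup>D\<close> positive. Resetting the treatments to \<open>D\<^sub>1\<close> one period at a time, from the last
  one back to \<open>F\<close>, then decomposes the effect as a telescoping sum of slopes.
\<close>

section \<open>The first change time of a path\<close>

text \<open>Bridges \<open>trt_path\<close>, which is \<open>undefined\<close> outside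
  \<open>{1..T}\<close>, and the unrestricted process read by \<open>F_of\<close>: the first change
  depends on periods up to \<open>T\<close> only, and \<open>T \<ge> 1\<close> puts the baseline
  period among them.\<close>

lemma first_change_cong:
  assumes "T \<ge> 1" "\<And>t. t \<in> {1..T} \<Longrightarrow> d t = e t"
  shows "first_change T d = first_change T e"
proof -
  have "(\<lambda>t. t \<in> {2..T} \<and> d t \<noteq> d 1) = (\<lambda>t. t \<in> {2..T} \<and> e t \<noteq> e 1)"
    using assms by (auto simp: fun_eq_iff)
  then show ?thesis
    unfolding first_change_def Bex_def by (simp only:)
qed

lemma first_change_ge:
  assumes "T \<ge> 1"
  shows "first_change T d \<ge> 2"
proof (cases "\<exists>t\<in>{2..T}. d t \<noteq> d 1")
  case True
  then have "Min {t \<in> {2..T}. d t \<noteq> d 1} \<in> {t \<in> {2..T}. d t \<noteq> d 1}"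
    by (intro Min_in) auto
  then show ?thesis
    using True by (auto simp: first_change_def)
qed (use assms in \<open>auto simp: first_change_def\<close>)

lemma first_change_neq:
  assumes "first_change T d \<le> T"
  shows "d (first_change T d) \<noteq> d 1"
proof -
  have ex: "\<exists>t\<in>{2..T}. d t \<noteq> d 1"
    using assms by (auto simp: first_change_def split: if_splits)
  then have "Min {t \<in> {2..T}. d t \<noteq> d 1} \<in> {t \<in> {2..T}. d t \<noteq> d 1}"
    by (intro Min_in) auto
  then show ?thesis
    using ex by (simp add: first_change_def)
qed

lemma eq_before_first_change:
  assumes "1 \<le> s" "s < first_change T d" "s \<le> T"
  shows "d s = d 1"
proof (rule ccontr)
  assume neq: "d s \<noteq> d 1"
  with assms have s: "s \<in> {t \<in> {2..T}. d t \<noteq> d 1}"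
    by (cases "s = 1") auto
  then have "first_change T d \<le> s"
    by (auto simp: first_change_def)
  with assms show False by simp
qed

section \<open>The conditioning event and the sign of the dose increments\<close>

text \<open>The largest possible value of F is T + 1. With l \<ge> 1 this bound removes
  never-changing paths from the conditioning event, since for them F - 1 + l exceeds T.\<close>

lemma Tbar_le:
  assumes "set_pmf (K x) \<subseteq> {2..T+1}"
  shows "Tbar K x \<le> T"
proof -
  have "finite (set_pmf (K x))"
    using assms finite_subset by blast
  moreover have "n - 1 \<le> T" if "n \<in> set_pmf (K x)" for n
    using subsetD[OF assms that] by auto
  ultimately show ?thesis
    using set_pmf_not_empty[of "K x"] by (auto simp: Tbar_def)
qed

lemma Dl_event_window:
  assumes T: "T \<ge> 1" and K: "\<And>x. set_pmf (K x) \<subseteq> {2..T+1}"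
    and l: "l \<ge> 1" and \<omega>: "\<omega> \<in> Dl_event M T K D l"
  shows "F_of T D \<omega> - 1 + l \<le> T"
    and "(\<forall>s\<in>{1<..F_of T D \<omega> - 1 + l}. D s \<omega> \<ge> D 1 \<omega>) \<or>
         (\<forall>s\<in>{1<..F_of T D \<omega> - 1 + l}. D s \<omega> \<le> D 1 \<omega>)"
proof -
  define d where "d = trt_path T D \<omega>"
  define t where "t = F_of T D \<omega> - 1 + l"
  have d: "d s = D s \<omega>" if "s \<in> {1..T}" for s
    using that by (simp add: d_def trt_path_def)
  have F: "first_change T d = F_of T D \<omega>"
    unfolding F_of_def by (rule first_change_cong) (use T d in auto)
  have dl: "d \<in> Dl M T K D l"
    using \<omega> by (simp add: Dl_event_def d_def)
  then have "t \<le> Tbar K (d 1)"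
    by (simp add: Dl_def F t_def)
  also have "\<dots> \<le> T"
    by (rule Tbar_le) (rule K)
  finally have tT: "t \<le> T" .
  then show "F_of T D \<omega> - 1 + l \<le> T"
    by (simp add: t_def)
  have "F_of T D \<omega> \<ge> 2"
    unfolding F_of_def by (rule first_change_ge[OF T])
  \<comment> \<open>\<open>Min\<close> and \<open>Max\<close> carry information only on nonempty
    sets; F - 1 + l \<ge> 2 puts period 2 in the window.\<close>
  then have ne: "d ` {1<..t} \<noteq> {}"
    using l by (auto simp: t_def)
  have "Min (d ` {1<..t}) \<ge> d 1 \<or> Max (d ` {1<..t}) \<le> d 1"
    using dl by (auto simp: Dl_def Dnc_def F t_def)
  then have "(\<forall>s\<in>{1<..t}. d s \<ge> d 1) \<or> (\<forall>s\<in>{1<..t}. d s \<le> d 1)"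
    using ne by (subst (asm) Min_ge_iff, simp, simp, subst (asm) Max_le_iff) auto
  moreover have "d s = D s \<omega>" if "s \<in> {1<..t}" for s
    using that tT by (intro d) auto
  moreover have "d 1 = D 1 \<omega>"
    using T by (intro d) auto
  ultimately show "(\<forall>s\<in>{1<..F_of T D \<omega> - 1 + l}. D s \<omega> \<ge> D 1 \<omega>) \<or>
         (\<forall>s\<in>{1<..F_of T D \<omega> - 1 + l}. D s \<omega> \<le> D 1 \<omega>)"
    unfolding t_def[symmetric] by auto
qed

text \<open>Period F itself lies in the window, so D at F and D at s are on the same side of the
  baseline; the sign S taken at F therefore agrees with the increment at s.\<close>

lemma S_of_increment_nonneg:
  assumes T: "T \<ge> 1" and K: "\<And>x. set_pmf (K x) \<subseteq> {2..T+1}"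
    and l: "l \<ge> 1" and \<omega>: "\<omega> \<in> Dl_event M T K D l"
    and s: "s \<in> {1<..F_of T D \<omega> - 1 + l}"
  shows "S_of T D \<omega> * (D s \<omega> - D 1 \<omega>) \<ge> 0"
proof -
  note window = Dl_event_window[OF T K l \<omega>]
  have "F_of T D \<omega> \<ge> 2"
    unfolding F_of_def by (rule first_change_ge[OF T])
  then have F: "F_of T D \<omega> \<in> {1<..F_of T D \<omega> - 1 + l}" "F_of T D \<omega> \<le> T"
    using l window(1) by auto
  show ?thesis
    using window(2)
  proof
    assume "\<forall>s\<in>{1<..F_of T D \<omega> - 1 + l}. D s \<omega> \<ge> D 1 \<omega>"
    then have "D (F_of T D \<omega>) \<omega> \<ge> D 1 \<omega>" "D s \<omega> \<ge> D 1 \<omega>"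
      using F(1) s by auto
    then show ?thesis
      using F(2) by (simp add: S_of_def)
  next
    assume "\<forall>s\<in>{1<..F_of T D \<omega> - 1 + l}. D s \<omega> \<le> D 1 \<omega>"
    then have "D (F_of T D \<omega>) \<omega> \<le> D 1 \<omega>" "D s \<omega> \<le> D 1 \<omega>"
      using F(1) s by auto
    then show ?thesis
      using F(2) by (simp add: S_of_def mult_nonpos_nonpos)
  qed
qed

text \<open>The summand k = 0 is the absolute size of the first change, which is nonzero; the other
  summands cannot offset it.\<close>

lemma dose_l_pos:
  assumes T: "T \<ge> 1" and K: "\<And>x. set_pmf (K x) \<subseteq> {2..T+1}"
    and l: "l \<ge> 1" and \<omega>: "\<omega> \<in> Dl_event M T K D l"
  shows "dose_l T D l \<omega> > 0"
proof -
  have F2: "F_of T D \<omega> \<ge> 2"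
    unfolding F_of_def by (rule first_change_ge[OF T])
  have FT: "F_of T D \<omega> \<le> T"
    using Dl_event_window(1)[OF T K l \<omega>] l F2 by simp
  have "D (F_of T D \<omega>) \<omega> \<noteq> D 1 \<omega>"
    using first_change_neq[of T "\<lambda>t. D t \<omega>"] FT by (simp add: F_of_def)
  \<comment> \<open>The \<open>+ 0\<close> gives this term the shape of the summand at k = 0, as
    \<open>sum_pos2\<close> requires.\<close>
  then have pos: "S_of T D \<omega> * (D (F_of T D \<omega> + 0) \<omega> - D 1 \<omega>) > 0"
    using FT by (simp add: S_of_def sgn_if)
  have "(\<Sum>k<l. S_of T D \<omega> * (D (F_of T D \<omega> + k) \<omega> - D 1 \<omega>)) > 0"
  proof (rule sum_pos2)
    show "0 < S_of T D \<omega> * (D (F_of T D \<omega> + 0) \<omega> - D 1 \<omega>)"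
      by (rule pos)
    show "0 \<le> S_of T D \<omega> * (D (F_of T D \<omega> + k) \<omega> - D 1 \<omega>)" if "k \<in> {..<l}" for k
      by (rule S_of_increment_nonneg[OF T K l \<omega>]) (use that F2 in auto)
  qed (use l in auto)
  then show ?thesis
    by (simp add: dose_l_def sum_distrib_left)
qed

text \<open>The weights run backwards from period F - 1 + l to F while the dose runs forwards, so
  reversing the index matches the two sums.\<close>

lemma sum_weight:
  assumes T: "T \<ge> 1"
  shows "(\<Sum>k<l. weight M T K D l k \<omega>) = dose_l T D l \<omega> / AVSQD M T K D l"
proof -
  have F2: "F_of T D \<omega> \<ge> 2"
    unfolding F_of_def by (rule first_change_ge[OF T])
  have "(\<Sum>k<l. D (F_of T D \<omega> - 1 + l - k) \<omega> - D 1 \<omega>)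
      = (\<Sum>k<l. D (F_of T D \<omega> - 1 + l - (l - Suc k)) \<omega> - D 1 \<omega>)"
    by (rule sum.nat_diff_reindex[symmetric])
  also have "\<dots> = (\<Sum>k<l. D (F_of T D \<omega> + k) \<omega> - D 1 \<omega>)"
  proof (rule sum.cong)
    fix k assume "k \<in> {..<l}"
    then have "F_of T D \<omega> - 1 + l - (l - Suc k) = F_of T D \<omega> + k"
      using F2 by auto
    then show "D (F_of T D \<omega> - 1 + l - (l - Suc k)) \<omega> - D 1 \<omega> = D (F_of T D \<omega> + k) \<omega> - D 1 \<omega>"
      by simp
  qed simp
  finally show ?thesis
    unfolding weight_def dose_l_def
    by (simp only: sum_divide_distrib[symmetric] sum_distrib_left[symmetric])
qed

section \<open>Telescoping over successively reset treatments\<close>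

lemma Y_reset_all: "Y_reset D Y t t \<omega> = Yobs D Y t \<omega>"
proof -
  have "history t (\<lambda>s. if s \<le> t then D s \<omega> else D 1 \<omega>) = history t (\<lambda>s. D s \<omega>)"
    by (auto simp: history_def)
  then show ?thesis
    by (simp add: Y_reset_def Yobs_def)
qed

lemma Y_reset_none:
  assumes "\<And>s. 1 \<le> s \<Longrightarrow> s \<le> m \<Longrightarrow> D s \<omega> = D 1 \<omega>"
  shows "Y_reset D Y m t \<omega> = Y t (history t (\<lambda>s. D 1 \<omega>)) \<omega>"
proof -
  have "history t (\<lambda>s. if s \<le> m then D s \<omega> else D 1 \<omega>) = history t (\<lambda>s. D 1 \<omega>)"
    using assms by (auto simp: history_def)
  then show ?thesis
    by (simp add: Y_reset_def)
qed

text \<open>Serves the periods where the treatment is back at its baseline value and the slope has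
  denominator zero: resetting such a period changes nothing.\<close>

lemma Y_reset_pred_eq:
  assumes "D m \<omega> = D 1 \<omega>"
  shows "Y_reset D Y (m - 1) t \<omega> = Y_reset D Y m t \<omega>"
proof -
  have "(\<lambda>s. if s \<le> m - 1 then D s \<omega> else D 1 \<omega>) = (\<lambda>s. if s \<le> m then D s \<omega> else D 1 \<omega>)"
  proof
    fix s
    show "(if s \<le> m - 1 then D s \<omega> else D 1 \<omega>) = (if s \<le> m then D s \<omega> else D 1 \<omega>)"
      using assms by (cases "s = m") auto
  qed
  then show ?thesis
    by (simp add: Y_reset_def)
qed

text \<open>The increment in the weight cancels the denominator of the slope, leaving a multiple of
  the difference of two consecutive resets; these differences telescope.\<close>

lemma sum_weight_SL:
  assumes T: "T \<ge> 1" and K: "\<And>x. set_pmf (K x) \<subseteq> {2..T+1}"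
    and l: "l \<ge> 1" and \<omega>: "\<omega> \<in> Dl_event M T K D l"
  shows "(\<Sum>k<l. weight M T K D l k \<omega> * SL T D Y l k \<omega>)
       = effect_l T D Y l \<omega> / AVSQD M T K D l"
proof -
  define t where "t = F_of T D \<omega> - 1 + l"
  \<comment> \<open>For k \<le> t, \<open>R k\<close> is the outcome at \<open>t\<close> with the
    last \<open>k\<close> treatments put back to the baseline.\<close>
  define R where "R = (\<lambda>k. Y_reset D Y (t - k) t \<omega>)"
  define c where "c = S_of T D \<omega> / AVSQD M T K D l"
  have F2: "F_of T D \<omega> \<ge> 2"
    unfolding F_of_def by (rule first_change_ge[OF T])
  have tT: "t \<le> T"
    using Dl_event_window(1)[OF T K l \<omega>] by (simp add: t_def)
  have "weight M T K D l k \<omega> * SL T D Y l k \<omega> = c * (R k - R (Suc k))" for k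
  proof (cases "D (t - k) \<omega> = D 1 \<omega>")
    \<comment> \<open>No cancellation is possible here, but both sides are zero: the weight vanishes
      and \<open>R k = R (Suc k)\<close>.\<close>
    case True
    with Y_reset_pred_eq[of D "t - k" \<omega> Y t] show ?thesis
      by (simp add: weight_def SL_def R_def t_def Let_def)
  next
    case False
    then show ?thesis
      unfolding weight_def SL_def R_def c_def Let_def t_def[symmetric] by simp
  qed
  then have "(\<Sum>k<l. weight M T K D l k \<omega> * SL T D Y l k \<omega>) = c * (\<Sum>k<l. R k - R (Suc k))"
    by (simp add: sum_distrib_left)
  also have "\<dots> = c * (R 0 - R l)"
    by (simp add: sum_lessThan_telescope')
  also have "R 0 = Yobs D Y t \<omega>"
    by (simp add: R_def Y_reset_all)
  also have "R l = Y t (history t (\<lambda>s. D 1 \<omega>)) \<omega>"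
    unfolding R_def
  \<comment> \<open>Since t - l = F - 1, the treatments still at their actual values precede the
    first change and equal the baseline.\<close>
  proof (rule Y_reset_none)
    fix s assume "1 \<le> s" "s \<le> t - l"
    then show "D s \<omega> = D 1 \<omega>"
      using F2 tT eq_before_first_change[of s T "\<lambda>t. D t \<omega>"] by (simp add: t_def F_of_def)
  qed
  finally show ?thesis
    by (simp add: effect_l_def c_def t_def Let_def)
qed

section \<open>Expectations conditional on an event\<close>

lemma event_expectation_divide:
  "event_expectation M A (\<lambda>\<omega>. X \<omega> / c) = event_expectation M A X / c"
  by (simp add: event_expectation_def)

lemma event_expectation_cong:
  assumes "\<And>\<omega>. \<omega> \<in> A \<Longrightarrow> X \<omega> = Z \<omega>"
  shows "event_expectation M A X = event_expectation M A Z"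
proof -
  have "(\<lambda>\<omega>. indicat_real A \<omega> *\<^sub>R X \<omega>) = (\<lambda>\<omega>. indicat_real A \<omega> *\<^sub>R Z \<omega>)"
    using assms by (auto simp: fun_eq_iff indicator_def)
  then show ?thesis
    by (simp add: event_expectation_def set_lebesgue_integral_def)
qed

text \<open>A nonnegative integrand with integral zero vanishes almost everywhere; as X is positive
  on A, this would make A a null set.\<close>

lemma event_expectation_pos:
  assumes A: "measure M A > 0" and int: "set_integrable M A X"
    and pos: "\<And>\<omega>. \<omega> \<in> A \<Longrightarrow> X \<omega> > 0"
  shows "event_expectation M A X > 0"
proof -
  \<comment> \<open>\<open>measure\<close> is 0 on non-measurable sets, so positive measure yields
    measurability.\<close>
  have sets: "A \<in> sets M"
    using A measure_notin_sets by fastforce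
  have int': "integrable M (\<lambda>\<omega>. indicat_real A \<omega> * X \<omega>)"
    using int by (simp add: set_integrable_def)
  have nonneg: "0 \<le> indicat_real A \<omega> * X \<omega>" for \<omega>
    using pos[of \<omega>] by (auto simp: indicator_def)
  have "(\<integral>\<omega>. indicat_real A \<omega> * X \<omega> \<partial>M) \<noteq> 0"
  proof
    assume "(\<integral>\<omega>. indicat_real A \<omega> * X \<omega> \<partial>M) = 0"
    then have "AE \<omega> in M. indicat_real A \<omega> * X \<omega> = 0"
      using integral_nonneg_eq_0_iff_AE[OF int'] nonneg by simp
    then have "AE \<omega> in M. \<omega> \<notin> A"
    proof eventually_elim
      case (elim \<omega>)
      then show ?case
        using pos[of \<omega>] by (auto simp: indicator_def)
    qed
    then have "emeasure M A = 0"
      using sets AE_iff_measurable[of A M "\<lambda>\<omega>. \<omega> \<notin> A"] sets.sets_into_space[OF sets] by auto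
    with A show False
      by (simp add: measure_def)
  qed
  moreover have "(\<integral>\<omega>. indicat_real A \<omega> * X \<omega> \<partial>M) \<ge> 0"
    by (rule Bochner_Integration.integral_nonneg) (rule nonneg)
  ultimately show ?thesis
    using A by (simp add: event_expectation_def set_lebesgue_integral_def)
qed

theorem theorem2:
  fixes M :: "'a measure" and T l :: nat
    and D :: "nat \<Rightarrow> 'a \<Rightarrow> real"
    and Y :: "nat \<Rightarrow> real list \<Rightarrow> 'a \<Rightarrow> real"
    and K :: "real \<Rightarrow> nat pmf"
  assumes "prob_space M"
    and "T \<ge> 1"
    and "\<And>t. t \<in> {1..T} \<Longrightarrow> D t \<in> borel_measurable M"
    and "\<And>t ds. t \<in> {1..T} \<Longrightarrow> length ds = t \<Longrightarrow> Y t ds \<in> borel_measurable M"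
    and "conditional_law M (D 1) (F_of T D) {2..T+1} K"
    and "l \<ge> 1"
    and "measure M (Dl_event M T K D l) > 0"
    and "set_integrable M (Dl_event M T K D l) (effect_l T D Y l)"
    and "set_integrable M (Dl_event M T K D l) (dose_l T D l)"
  shows "AVSQn M T K D Y l =
           event_expectation M (Dl_event M T K D l)
             (\<lambda>\<omega>. \<Sum>k<l. weight M T K D l k \<omega> * SL T D Y l k \<omega>)
       \<and> event_expectation M (Dl_event M T K D l) (\<lambda>\<omega>. \<Sum>k<l. weight M T K D l k \<omega>) = 1
       \<and> (\<forall>\<omega> \<in> Dl_event M T K D l. \<forall>k<l. weight M T K D l k \<omega> \<ge> 0)"
proof -
  note T = assms(2) and l = assms(6)
  have K: "set_pmf (K x) \<subseteq> {2..T+1}" for x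
    using assms(5) by (simp add: conditional_law_def)
  let ?A = "Dl_event M T K D l"
  \<comment> \<open>Positivity makes the normalised weights average to one and lets them inherit the
    sign of the dose increments.\<close>
  have pos: "AVSQD M T K D l > 0"
    unfolding AVSQD_def
    by (rule event_expectation_pos[OF assms(7,9)]) (rule dose_l_pos[OF T K l])
  have "event_expectation M ?A (\<lambda>\<omega>. \<Sum>k<l. weight M T K D l k \<omega> * SL T D Y l k \<omega>)
      = event_expectation M ?A (\<lambda>\<omega>. effect_l T D Y l \<omega> / AVSQD M T K D l)"
    by (rule event_expectation_cong) (rule sum_weight_SL[OF T K l])
  also have "\<dots> = AVSQn M T K D Y l"
    by (simp add: event_expectation_divide AVSQn_def AVSQ_def)
  finally have 1: "AVSQn M T K D Y l =
      event_expectation M ?A (\<lambda>\<omega>. \<Sum>k<l. weight M T K D l k \<omega> * SL T D Y l k \<omega>)" ..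
  have "event_expectation M ?A (\<lambda>\<omega>. \<Sum>k<l. weight M T K D l k \<omega>)
      = AVSQD M T K D l / AVSQD M T K D l"
    by (simp add: sum_weight[OF T] event_expectation_divide AVSQD_def)
  then have 2: "event_expectation M ?A (\<lambda>\<omega>. \<Sum>k<l. weight M T K D l k \<omega>) = 1"
    using pos by simp
  have 3: "weight M T K D l k \<omega> \<ge> 0" if \<omega>: "\<omega> \<in> ?A" and k: "k < l" for \<omega> k
  proof -
    have "F_of T D \<omega> \<ge> 2"
      unfolding F_of_def by (rule first_change_ge[OF T])
    \<comment> \<open>As k < l, the index is at least F, hence beyond period 1.\<close>
    then have "F_of T D \<omega> - 1 + l - k \<in> {1<..F_of T D \<omega> - 1 + l}"
      using k by auto
    from S_of_increment_nonneg[OF T K l \<omega> this] pos show ?thesis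
      by (simp add: weight_def)
  qed
  from 1 2 3 show ?thesis
    by blast
qed

end
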